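(* Suppose that the undirected graph $\mathcal G$ is connected. A matrix $X^*\in\mathbb R^{r\times p}$ is a least squares solution to the matrix equation $AXB=F$ if and only if there exist $X_{\rm E}^*=1_n\otimes X^*$, $Y^*\in\mathbb R^{r\times q}$, $Z^*\in\mathbb R^{nr\times q}$, $U^*\in\mathbb R^{nm\times q}$ and $W^*\in\mathbb R^{nm\times q}$ such that $(X_{\rm E}^*,Y^*,Z^*,U^*,W^* )$ is a solution to the optimization problem $$\begin{aligned}\min_{X_{\rm E},Y,U,W,Z}\ &\sum_{i=1}^n\|A_{li}Y_{vi}-[F_{vi}]_{\rm R}-U_i\|_{\rm F}^2\\ \text{s.t.}\ & X_i=X_j,\quad U_i=\sum_{j=1}^n a_{i,j}(W_i-W_j),\\ &[Y_{vi}]_{\rm R}-X_i[B_{li}]_{\rm C}-\sum_{j=1}^n a_{i,j}(Z_i-Z_j)=0_{r\times q},\quad i,j\in\{1,\ldots,n\}.\end{aligned}$$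
   Context: $A\in\mathbb R^{m\times r}$, $B\in\mathbb R^{p\times q}$, $F\in\mathbb R^{m\times q}$ are partitioned (Column-Column-Row structure) as $A=[A_{l1},\ldots,A_{ln}]$, $B=[B_{l1},\ldots,B_{ln}]$, $F=[F_{v1}^{\rm T},\ldots,F_{vn}^{\rm T}]^{\rm T}$ with $A_{li}\in\mathbb R^{m\times r_i}$, $B_{li}\in\mathbb R^{p\times q_i}$, $F_{vi}\in\mathbb R^{m_i\times q}$, $\sum_i r_i=r$, $\sum_i q_i=q$, $\sum_i m_i=m$. The variables are $X_{\rm E}=[X_1^{\rm T},\ldots,X_n^{\rm T}]^{\rm T}\in\mathbb R^{nr\times p}$ with $X_i\in\mathbb R^{r\times p}$; $Y=[Y_{v1}^{\rm T},\ldots,Y_{vn}^{\rm T}]^{\rm T}\in\mathbb R^{r\times q}$ with $Y_{vi}\in\mathbb R^{r_i\times q}$; $U=[U_1^{\rm T},\ldots,U_n^{\rm T}]^{\rm T}$ and $W=[W_1^{\rm T},\ldots,W_n^{\rm T}]^{\rm T}$ in $\mathbb R^{nm\times q}$ with $U_i,W_i\in\mathbb R^{m\times q}$; $Z=[Z_1^{\rm T},\ldots,Z_n^{\rm T}]^{\rm T}\in\mathbb R^{nr\times q}$ with $Z_i\in\mathbb R^{r\times q}$. Augmented matrices: $[Y_{vi}]_{\rm R}\in\mathbb R^{r\times q}$ has $i$th row-block (for the row partition $r_1,\ldots,r_n$) equal to $Y_{vi}$ and zeros elsewhere; $[F_{vi}]_{\rm R}\in\mathbb R^{m\times q}$ has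 $i$th row-block (partition $m_1,\ldots,m_n$) equal to $F_{vi}$ and zeros elsewhere; $[B_{li}]_{\rm C}\in\mathbb R^{p\times q}$ has $i$th column-block (partition $q_1,\ldots,q_n$) equal to $B_{li}$ and zeros elsewhere. $\mathcal G$ is an undirected graph on $\{1,\ldots,n\}$ with symmetric adjacency matrix $[a_{i,j}]$, $a_{i,j}=a_{j,i}>0$ if $\{j,i\}$ is an edge and $a_{i,j}=0$ otherwise. $1_n$ is the all-ones column vector, $\otimes$ the Kronecker product. A least squares solution to $AXB=F$ is a minimizer of $\|AXB-F\|_{\rm F}^2$ over $X\in\mathbb R^{r\times p}$. *)

theory Defs
  imports Jordan_Normal_Form.Matrix Graph_Theory.Pair_Digraph
    Graph_Theory.Digraph_Component
begin

text \<open>Block and node indices are zero-based: node \<open>i\<close> of \<open>{1, \<dots>, n}\<close> is \<open>i - 1\<close> here.\<close>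

definition frobenius_norm :: "real mat \<Rightarrow> real" where
  "frobenius_norm M = sqrt (\<Sum>k<dim_row M. \<Sum>l<dim_col M. (M $$ (k, l))\<^sup>2)"

definition kronecker :: "real mat \<Rightarrow> real mat \<Rightarrow> real mat" where
  "kronecker M N = mat (dim_row M * dim_row N) (dim_col M * dim_col N)
     (\<lambda>(k, l). M $$ (k div dim_row N, l div dim_col N) * N $$ (k mod dim_row N, l mod dim_col N))"

definition ones_col :: "nat \<Rightarrow> real mat" where
  "ones_col n = mat n 1 (\<lambda>_. 1)"

definition mat_sum :: "nat \<Rightarrow> nat \<Rightarrow> (nat \<Rightarrow> real mat) \<Rightarrow> nat set \<Rightarrow> real mat" where
  "mat_sum nr nc f I = mat nr nc (\<lambda>(k, l). \<Sum>j\<in>I. f j $$ (k, l))"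

text \<open>A partition of the rows (or columns) is given by its block sizes \<open>d 0, d 1, \<dots>\<close>;
  block \<open>i\<close> consists of the \<open>d i\<close> consecutive indices starting at \<open>offset d i\<close>.\<close>

definition offset :: "(nat \<Rightarrow> nat) \<Rightarrow> nat \<Rightarrow> nat" where
  "offset d i = (\<Sum>j<i. d j)"

definition row_block :: "(nat \<Rightarrow> nat) \<Rightarrow> nat \<Rightarrow> real mat \<Rightarrow> real mat" where
  "row_block d i M = mat (d i) (dim_col M) (\<lambda>(k, l). M $$ (offset d i + k, l))"

definition col_block :: "(nat \<Rightarrow> nat) \<Rightarrow> nat \<Rightarrow> real mat \<Rightarrow> real mat" where
  "col_block d i M = mat (dim_row M) (d i) (\<lambda>(k, l). M $$ (k, offset d i + l))"

text \<open>\<open>aug_rows d n i N\<close> and \<open>aug_cols d n i N\<close> are \<open>[N]\<^sub>R\<close> and \<open>[N]\<^sub>C\<close>: the block \<open>N\<close> is put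
  at position \<open>i\<close> of the partition \<open>d 0, \<dots>, d (n - 1)\<close>.\<close>

definition aug_rows :: "(nat \<Rightarrow> nat) \<Rightarrow> nat \<Rightarrow> nat \<Rightarrow> real mat \<Rightarrow> real mat" where
  "aug_rows d n i N = mat (offset d n) (dim_col N)
     (\<lambda>(k, l). if offset d i \<le> k \<and> k < offset d i + d i then N $$ (k - offset d i, l) else 0)"

definition aug_cols :: "(nat \<Rightarrow> nat) \<Rightarrow> nat \<Rightarrow> nat \<Rightarrow> real mat \<Rightarrow> real mat" where
  "aug_cols d n i N = mat (dim_row N) (offset d n)
     (\<lambda>(k, l). if offset d i \<le> l \<and> l < offset d i + d i then N $$ (k, l - offset d i) else 0)"

text \<open>The \<open>i\<close>th of the equally sized blocks, with \<open>s\<close> rows each, of a stacked variable.\<close>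

abbreviation stack_block :: "nat \<Rightarrow> nat \<Rightarrow> real mat \<Rightarrow> real mat" where
  "stack_block s i M \<equiv> row_block (\<lambda>_. s) i M"

lemma stack_block_kronecker_ones:
  assumes "X \<in> carrier_mat r p" "i < n"
  shows "stack_block r i (kronecker (ones_col n) X) = X"
proof (rule eq_matI)
  fix k l assume "k < dim_row X" "l < dim_col X"
  moreover from this assms have "i * r + k < n * r"
    by (metis carrier_matD(1) add_less_mono1 add.commute less_le_trans mult_Suc mult_le_mono1 Suc_leI)
  ultimately show "stack_block r i (kronecker (ones_col n) X) $$ (k, l) = X $$ (k, l)"
    using assms by (auto simp: row_block_def kronecker_def ones_col_def offset_def)
qed (use assms in \<open>auto simp: row_block_def kronecker_def ones_col_def\<close>)

text \<open>\<open>pair_graph\<close> is the library's finite simple undirected graph: a loop-free digraph whose arc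
  set is symmetric.\<close>

definition weighted_adjacency :: "nat \<Rightarrow> nat pair_pre_digraph \<Rightarrow> real mat \<Rightarrow> bool" where
  "weighted_adjacency n G a \<longleftrightarrow> a \<in> carrier_mat n n \<and>
     (\<forall>i<n. \<forall>j<n. a $$ (i, j) = a $$ (j, i) \<and>
        ((j, i) \<in> parcs G \<longrightarrow> a $$ (i, j) > 0) \<and>
        ((j, i) \<notin> parcs G \<longrightarrow> a $$ (i, j) = 0))"

text \<open>\<open>\<Sum>\<^sub>j a\<^sub>i\<^sub>j (V\<^sub>i - V\<^sub>j)\<close> for a stacked \<open>V\<close> with blocks of size \<open>s \<times> q\<close>.\<close>

definition coupling :: "nat \<Rightarrow> real mat \<Rightarrow> nat \<Rightarrow> nat \<Rightarrow> real mat \<Rightarrow> nat \<Rightarrow> real mat" where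
  "coupling n a s q V i =
     mat_sum s q (\<lambda>j. a $$ (i, j) \<cdot>\<^sub>m (stack_block s i V - stack_block s j V)) {..<n}"

definition least_squares_solution ::
    "nat \<Rightarrow> nat \<Rightarrow> real mat \<Rightarrow> real mat \<Rightarrow> real mat \<Rightarrow> real mat \<Rightarrow> bool" where
  "least_squares_solution r p A B F Xs \<longleftrightarrow>
     is_arg_min (\<lambda>X. (frobenius_norm (A * X * B - F))\<^sup>2) (\<lambda>X. X \<in> carrier_mat r p) Xs"

text \<open>Variables are ordered \<open>(X\<^sub>E, Y, U, W, Z)\<close>; \<open>rs\<close>, \<open>qs\<close>, \<open>ms\<close> are the block sizes
  \<open>r\<^sub>i\<close>, \<open>q\<^sub>i\<close>, \<open>m\<^sub>i\<close>.\<close>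

type_synonym vars = "real mat \<times> real mat \<times> real mat \<times> real mat \<times> real mat"

definition ccr_objective ::
    "nat \<Rightarrow> (nat \<Rightarrow> nat) \<Rightarrow> (nat \<Rightarrow> nat) \<Rightarrow> real mat \<Rightarrow> real mat \<Rightarrow> vars \<Rightarrow> real" where
  "ccr_objective n rs ms A F = (\<lambda>(XE, Y, U, W, Z).
     \<Sum>i<n. (frobenius_norm (col_block rs i A * row_block rs i Y
                - aug_rows ms n i (row_block ms i F)
                - stack_block (dim_row A) i U))\<^sup>2)"

definition ccr_feasible ::
    "nat \<Rightarrow> nat \<Rightarrow> nat \<Rightarrow> nat \<Rightarrow> nat \<Rightarrow> (nat \<Rightarrow> nat) \<Rightarrow> (nat \<Rightarrow> nat) \<Rightarrow> real mat \<Rightarrow> real mat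
      \<Rightarrow> vars \<Rightarrow> bool" where
  "ccr_feasible n m p q r rs qs a B = (\<lambda>(XE, Y, U, W, Z).
     XE \<in> carrier_mat (n * r) p \<and> Y \<in> carrier_mat r q \<and>
     U \<in> carrier_mat (n * m) q \<and> W \<in> carrier_mat (n * m) q \<and> Z \<in> carrier_mat (n * r) q \<and>
     (\<forall>i<n. \<forall>j<n. stack_block r i XE = stack_block r j XE) \<and>
     (\<forall>i<n. stack_block m i U = coupling n a m q W i) \<and>
     (\<forall>i<n. aug_rows rs n i (row_block rs i Y)
              - stack_block r i XE * aug_cols qs n i (col_block qs i B)
              - coupling n a r q Z i = 0\<^sub>m r q))"

end

theory Submission
  imports Defs Jordan_Normal_Form.Determinant "HOL-Analysis.Convex"
begin

text \<open>Summing the constraints over all nodes eliminates the coupling terms and gives \<open>Y = X B\<close>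
  and \<open>\<Sum>\<^sub>i U\<^sub>i = 0\<close>, so the residuals of the nodes add up to \<open>A X B - F\<close> and, by Cauchy-Schwarz,
  the objective is at least \<open>\<parallel>A X B - F\<parallel>\<^sup>2 / n\<close>. On a connected graph the Laplacian reaches every
  family with sum zero; hence \<open>U\<close> can be chosen so as to average the residuals, and the bound is
  attained for every \<open>X\<close>.\<close>

section \<open>The Laplacian of a connected graph\<close>

text \<open>Connectedness is reachability in the symmetric closure, where a walk may traverse an arc
  of \<open>G\<close> in either direction. Equality of values is symmetric, so \<open>step\<close>
  covers both directions and induction along the walk applies.\<close>

lemma constant_on_connected:
  assumes "Digraph_Component.connected (with_proj G)"
    and step: "\<And>u v. (u, v) \<in> parcs G \<Longrightarrow> f u = f v"
    and "u \<in> pverts G" "v \<in> pverts G"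
  shows "f u = f v"
proof -
  have "u \<rightarrow>\<^sup>*\<^bsub>with_proj (mk_symmetric (with_proj G))\<^esub> v"
    using assms by (auto simp: Digraph_Component.connected_def strongly_connected_def)
  then show ?thesis
    unfolding reachable_def
    by (induction rule: rtrancl_on_induct) (auto simp: parcs_mk_symmetric dest: step)
qed

text \<open>Exchanging the two summation indices turns the double sum into its own negative, since
  \<open>c\<close> is symmetric and \<open>w i - w j\<close> is antisymmetric.\<close>

lemma sum_laplacian_zero:
  fixes w :: "nat \<Rightarrow> real"
  assumes "\<And>i j. i < n \<Longrightarrow> j < n \<Longrightarrow> c i j = c j i"
  shows "(\<Sum>i<n. \<Sum>j<n. c i j * (w i - w j)) = 0"
proof -
  have "(\<Sum>i<n. \<Sum>j<n. c i j * (w i - w j)) = (\<Sum>j<n. \<Sum>i<n. c i j * (w i - w j))"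
    by (rule sum.swap)
  also have "\<dots> = (\<Sum>j<n. \<Sum>i<n. - (c j i * (w j - w i)))"
    using assms by (intro sum.cong) (auto simp: algebra_simps)
  finally show ?thesis by (simp add: sum_negf)
qed

text \<open>This is the Dirichlet form of the Laplacian. Write \<open>(w i - w j)\<^sup>2\<close> as
  \<open>w i * (w i - w j) + w j * (w j - w i)\<close>; the two halves have equal sums after
  exchanging the indices.\<close>

lemma laplacian_energy:
  fixes w :: "nat \<Rightarrow> real"
  assumes "\<And>i j. i < n \<Longrightarrow> j < n \<Longrightarrow> c i j = c j i"
  shows "(\<Sum>i<n. \<Sum>j<n. c i j * (w i - w j)\<^sup>2) = 2 * (\<Sum>i<n. w i * (\<Sum>j<n. c i j * (w i - w j)))"
proof -
  have "(\<Sum>i<n. \<Sum>j<n. c i j * (w i - w j)\<^sup>2)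
      = (\<Sum>i<n. \<Sum>j<n. w i * (c i j * (w i - w j))) + (\<Sum>i<n. \<Sum>j<n. w j * (c i j * (w j - w i)))"
    by (simp add: sum.distrib[symmetric] power2_eq_square algebra_simps)
  also have "(\<Sum>i<n. \<Sum>j<n. w j * (c i j * (w j - w i))) = (\<Sum>j<n. \<Sum>i<n. w j * (c i j * (w j - w i)))"
    by (rule sum.swap)
  also have "\<dots> = (\<Sum>j<n. \<Sum>i<n. w j * (c j i * (w j - w i)))"
    using assms by (intro sum.cong) auto
  finally show ?thesis by (simp add: sum_distrib_left)
qed

text \<open>A kernel vector has zero energy. All terms of the energy are nonnegative, so each
  vanishes, and the positive weight of an arc forces equal values at its ends; connectedness spreads
  the equality to all nodes.\<close>

lemma laplacian_kernel_constant:
  fixes w :: "nat \<Rightarrow> real"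
  assumes nodes: "pverts G = {..<n}" and wf: "pair_graph G"
    and adj: "weighted_adjacency n G a"
    and conn: "Digraph_Component.connected (with_proj G)"
    and kernel: "\<And>i. i < n \<Longrightarrow> (\<Sum>j<n. a $$ (i, j) * (w i - w j)) = 0"
    and "i < n" "j < n"
  shows "w i = w j"
proof -
  interpret pair_graph G by fact
  have nonneg: "a $$ (i, j) * (w i - w j)\<^sup>2 \<ge> 0" if "i < n" "j < n" for i j
  proof -
    have "a $$ (i, j) \<ge> 0"
      using adj that unfolding weighted_adjacency_def by (metis less_eq_real_def order_refl)
    then show ?thesis by simp
  qed
  have sym: "\<And>i j. i < n \<Longrightarrow> j < n \<Longrightarrow> a $$ (i, j) = a $$ (j, i)"
    using adj by (auto simp: weighted_adjacency_def)
  have "(\<Sum>i<n. \<Sum>j<n. a $$ (i, j) * (w i - w j)\<^sup>2) = 0"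
    using laplacian_energy[of n "\<lambda>i j. a $$ (i, j)" w, OF sym] kernel by simp
  then have zero: "a $$ (i, j) * (w i - w j)\<^sup>2 = 0" if "i < n" "j < n" for i j
  proof -
    have "(\<Sum>j<n. a $$ (i, j) * (w i - w j)\<^sup>2) = 0"
      using sum_nonneg_0[OF _ _ \<open>(\<Sum>i<n. \<Sum>j<n. a $$ (i, j) * (w i - w j)\<^sup>2) = 0\<close>, of i] nonneg that
      by (auto intro: sum_nonneg)
    then show ?thesis
      using sum_nonneg_0[of "{..<n}" "\<lambda>j. a $$ (i, j) * (w i - w j)\<^sup>2" j] nonneg that by blast
  qed
  have "w u = w v" if arc: "(u, v) \<in> parcs G" for u v
  proof -
    have "u < n" "v < n" using wellformed[OF arc] nodes by auto
    \<comment> \<open>\<open>weighted_adjacency\<close> ties the arc \<open>(j, i)\<close> to the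
      entry \<open>(i, j)\<close>, hence the reversed indices.\<close>
    moreover from this have "a $$ (v, u) > 0"
      using adj arc unfolding weighted_adjacency_def by blast
    ultimately show ?thesis using zero[of v u] by simp
  qed
  then show ?thesis
    using constant_on_connected[OF conn, of w] nodes \<open>i < n\<close> \<open>j < n\<close> by blast
qed

text \<open>The range of the symmetric Laplacian is the orthogonal complement of its kernel, which
  consists of the constant vectors. This later supplies the entries of \<open>W\<close> and
  \<open>Z\<close>.\<close>

lemma laplacian_surj_sum_zero:
  fixes b :: "nat \<Rightarrow> real"
  assumes nodes: "pverts G = {..<n}" and wf: "pair_graph G"
    and adj: "weighted_adjacency n G a"
    and conn: "Digraph_Component.connected (with_proj G)"
    and b: "(\<Sum>i<n. b i) = 0"
  obtains w where "\<And>i. i < n \<Longrightarrow> (\<Sum>j<n. a $$ (i, j) * (w i - w j)) = b i"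
proof -
  have sym: "\<And>i j. i < n \<Longrightarrow> j < n \<Longrightarrow> a $$ (i, j) = a $$ (j, i)"
    using adj by (auto simp: weighted_adjacency_def)
  \<comment> \<open>Adding the all-ones matrix to the Laplacian makes it invertible without changing its
    action on vectors with sum zero.\<close>
  define M where "M = mat n n (\<lambda>(i, j). (if i = j then \<Sum>k<n. a $$ (i, k) else 0) - a $$ (i, j) + 1)"
  have M: "M \<in> carrier_mat n n" by (simp add: M_def)
  have Mv: "(M *\<^sub>v v) $ i = (\<Sum>j<n. a $$ (i, j) * (v $ i - v $ j)) + (\<Sum>j<n. v $ j)"
    if v: "v \<in> carrier_vec n" and i: "i < n" for v i
  proof -
    have "(M *\<^sub>v v) $ i = (\<Sum>j<n. ((if i = j then \<Sum>k<n. a $$ (i, k) else 0) - a $$ (i, j) + 1) * v $ j)"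
      using v i by (simp add: M_def scalar_prod_def atLeast0LessThan)
    also have "\<dots> = (\<Sum>j<n. (if i = j then (\<Sum>k<n. a $$ (i, k)) * v $ j else 0)
        - a $$ (i, j) * v $ j + v $ j)"
      by (intro sum.cong) (auto simp: algebra_simps)
    also have "\<dots> = (\<Sum>j<n. if i = j then (\<Sum>k<n. a $$ (i, k)) * v $ j else 0)
        - (\<Sum>j<n. a $$ (i, j) * v $ j) + (\<Sum>j<n. v $ j)"
      by (simp add: sum.distrib sum_subtractf)
    also have "(\<Sum>j<n. if i = j then (\<Sum>k<n. a $$ (i, k)) * v $ j else 0) = (\<Sum>k<n. a $$ (i, k)) * v $ i"
      using i by simp
    finally show ?thesis
      by (simp add: algebra_simps sum_subtractf sum_distrib_left)
  qed
  \<comment> \<open>The Laplacian part cancels over the nodes, and the all-ones part contributes the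
    sum of \<open>v\<close> once per row.\<close>
  have total: "(\<Sum>i<n. (M *\<^sub>v v) $ i) = n * (\<Sum>j<n. v $ j)" if "v \<in> carrier_vec n" for v
    using that sum_laplacian_zero[of n "\<lambda>i j. a $$ (i, j)" "\<lambda>i. v $ i"] sym
    by (simp add: Mv sum.distrib)
  \<comment> \<open>Injectivity of \<open>M\<close>: by \<open>total\<close> a kernel vector has sum
    zero, so the Laplacian alone annihilates it; hence it is constant, and a constant vector with
    sum zero is zero.\<close>
  have "v = 0\<^sub>v n" if v: "v \<in> carrier_vec n" and "M *\<^sub>v v = 0\<^sub>v n" for v
  proof (cases "n = 0")
    case False
    have sum0: "(\<Sum>j<n. v $ j) = 0" using total[OF v] that(2) False by simp
    then have "(\<Sum>j<n. a $$ (i, j) * (v $ i - v $ j)) = 0" if "i < n" for i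
      using Mv[OF v that] \<open>M *\<^sub>v v = 0\<^sub>v n\<close> that by simp
    then have const: "v $ j = v $ i" if "i < n" "j < n" for i j
      using laplacian_kernel_constant[OF nodes wf adj conn, of "\<lambda>i. v $ i"] that by blast
    have "v $ i = 0" if "i < n" for i
    proof -
      have "(\<Sum>j<n. v $ j) = (\<Sum>j<n. v $ i)"
        using const[OF that] by (intro sum.cong) auto
      then show ?thesis using sum0 False by simp
    qed
    then show ?thesis using v by (intro eq_vecI) auto
  qed (use v in auto)
  then have "det M \<noteq> 0" by (metis det_0_iff_vec_prod_zero_field[OF M])
  then have "M \<in> Units (ring_mat TYPE(real) n ())" by (rule det_non_zero_imp_unit[OF M])
  then obtain N where N: "N \<in> carrier_mat n n" "M * N = 1\<^sub>m n"
    unfolding Units_def ring_mat_def by auto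
  define v where "v = N *\<^sub>v vec n b"
  have v: "v \<in> carrier_vec n" using N by (simp add: v_def)
  have "M *\<^sub>v v = (M * N) *\<^sub>v vec n b"
    unfolding v_def by (rule assoc_mult_mat_vec[symmetric]) (use M N in auto)
  then have solves: "M *\<^sub>v v = vec n b" by (simp add: N)
  \<comment> \<open>Since \<open>b\<close> has sum zero, so has the solution \<open>v\<close>; the
    all-ones part of \<open>M\<close> then drops out and \<open>v\<close> solves the Laplacian
    system itself.\<close>
  then have "n * (\<Sum>j<n. v $ j) = 0" using total[OF v] b by simp
  then have "(\<Sum>j<n. a $$ (i, j) * (v $ i - v $ j)) = b i" if "i < n" for i
    using Mv[OF v that] solves that by auto
  then show thesis by (rule that)
qed

section \<open>Block matrices\<close>

lemma frobenius_norm_sq: "(frobenius_norm M)\<^sup>2 = (\<Sum>k<dim_row M. \<Sum>l<dim_col M. (M $$ (k, l))\<^sup>2)"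
  unfolding frobenius_norm_def by (intro real_sqrt_pow2 sum_nonneg) auto

lemma index_mult_mat_sum:
  assumes "M \<in> carrier_mat k s" "N \<in> carrier_mat s l" "i < k" "j < l"
  shows "(M * N) $$ (i, j) = (\<Sum>x<s. M $$ (i, x) * N $$ (x, j))"
  using assms by (simp add: scalar_prod_def atLeast0LessThan)

lemma offset_Suc [simp]: "offset d (Suc i) = offset d i + d i"
  by (simp add: offset_def)

lemma offset_const: "offset (\<lambda>_. s) i = i * s"
  by (simp add: offset_def)

lemma offset_block_le: "i < n \<Longrightarrow> offset d i + d i \<le> offset d n"
  using sum_mono2[of "{..<n}" "{..<Suc i}" d] by (auto simp: offset_def)

lemma sum_offset_blocks:
  fixes g :: "nat \<Rightarrow> 'a :: comm_monoid_add"
  shows "(\<Sum>x<offset d n. g x) = (\<Sum>i<n. \<Sum>k<d i. g (offset d i + k))"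
proof (induction n)
  case (Suc n)
  have "(\<Sum>x<s + t. g x) = (\<Sum>x<s. g x) + (\<Sum>k<t. g (s + k))" for s t
    by (induction t) (auto simp: add.assoc)
  then show ?case using Suc by simp
qed (simp add: offset_def)

text \<open>Every index below \<open>offset d n\<close> lies in exactly one block; empty blocks
  contain no index and do no harm.\<close>

lemma sum_block_indicator:
  assumes "k < offset d n"
  shows "(\<Sum>i<n. if offset d i \<le> k \<and> k < offset d i + d i then c else 0) = (c :: real)"
proof -
  \<comment> \<open>The bound on \<open>k\<close> moves into the value, because the induction on
    \<open>n\<close> must also treat indices that only the next block reaches.\<close>
  have "(\<Sum>i<n. if offset d i \<le> k \<and> k < offset d i + d i then c else 0) = (if k < offset d n then c else 0)"
    by (induction n) (auto simp: offset_def)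
  then show ?thesis using assms by simp
qed

lemma sum_aug_rows:
  assumes M: "M \<in> carrier_mat (offset d n) c" and k: "k < offset d n" "l < c"
  shows "(\<Sum>i<n. aug_rows d n i (row_block d i M) $$ (k, l)) = M $$ (k, l)"
proof -
  have "(\<Sum>i<n. aug_rows d n i (row_block d i M) $$ (k, l))
      = (\<Sum>i<n. if offset d i \<le> k \<and> k < offset d i + d i then M $$ (k, l) else 0)"
    using assms by (intro sum.cong) (auto simp: aug_rows_def row_block_def)
  then show ?thesis using sum_block_indicator[OF k(1)] by simp
qed

lemma sum_aug_cols:
  assumes M: "M \<in> carrier_mat c (offset d n)" and l: "k < c" "l < offset d n"
  shows "(\<Sum>i<n. aug_cols d n i (col_block d i M) $$ (k, l)) = M $$ (k, l)"
proof -
  have "(\<Sum>i<n. aug_cols d n i (col_block d i M) $$ (k, l))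
      = (\<Sum>i<n. if offset d i \<le> l \<and> l < offset d i + d i then M $$ (k, l) else 0)"
    using assms by (intro sum.cong) (auto simp: aug_cols_def col_block_def)
  then show ?thesis using sum_block_indicator[OF l(2)] by simp
qed

lemma dim_blocks [simp]:
  "dim_row (row_block d i M) = d i" "dim_col (row_block d i M) = dim_col M"
  "dim_row (col_block d i M) = dim_row M" "dim_col (col_block d i M) = d i"
  "dim_row (aug_rows d n i N) = offset d n" "dim_col (aug_rows d n i N) = dim_col N"
  "dim_row (aug_cols d n i N) = dim_row N" "dim_col (aug_cols d n i N) = offset d n"
  by (auto simp: row_block_def col_block_def aug_rows_def aug_cols_def)

text \<open>The inner summation index of the product is split along the partition \<open>d\<close>;
  each node contributes one segment of it.\<close>

lemma sum_col_block_mult_row_block: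
  assumes M: "M \<in> carrier_mat s (offset d n)" and N: "N \<in> carrier_mat (offset d n) t"
    and k: "k < s" "l < t"
  shows "(\<Sum>i<n. (col_block d i M * row_block d i N) $$ (k, l)) = (M * N) $$ (k, l)"
proof -
  have "(col_block d i M * row_block d i N) $$ (k, l)
      = (\<Sum>x<d i. M $$ (k, offset d i + x) * N $$ (offset d i + x, l))" for i
    using assms by (subst index_mult_mat_sum[where k = s and s = "d i" and l = t])
      (auto simp: row_block_def col_block_def)
  then show ?thesis
    using index_mult_mat_sum[OF M N k] by (simp add: sum_offset_blocks)
qed

lemma sum_mult_aug_cols:
  assumes M: "M \<in> carrier_mat s t" and N: "N \<in> carrier_mat t (offset d n)"
    and k: "k < s" "l < offset d n"
  shows "(\<Sum>i<n. (M * aug_cols d n i (col_block d i N)) $$ (k, l)) = (M * N) $$ (k, l)"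
proof -
  have "(M * aug_cols d n i (col_block d i N)) $$ (k, l)
      = (\<Sum>x<t. M $$ (k, x) * aug_cols d n i (col_block d i N) $$ (x, l))" for i
    using M N k by (intro index_mult_mat_sum) (auto intro!: carrier_matI)
  then have "(\<Sum>i<n. (M * aug_cols d n i (col_block d i N)) $$ (k, l))
      = (\<Sum>x<t. M $$ (k, x) * (\<Sum>i<n. aug_cols d n i (col_block d i N) $$ (x, l)))"
    by (simp add: sum_distrib_left) (rule sum.swap)
  also have "\<dots> = (\<Sum>x<t. M $$ (k, x) * N $$ (x, l))"
    using sum_aug_cols[OF N _ k(2)] by (intro sum.cong) auto
  also have "\<dots> = (M * N) $$ (k, l)" by (rule index_mult_mat_sum[OF M N k, symmetric])
  finally show ?thesis .
qed

section \<open>Stacked variables and the coupling map\<close>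

definition stack :: "nat \<Rightarrow> nat \<Rightarrow> nat \<Rightarrow> (nat \<Rightarrow> nat \<Rightarrow> nat \<Rightarrow> real) \<Rightarrow> real mat" where
  "stack n s q g = mat (n * s) q (\<lambda>(k, l). g (k div s) (k mod s) l)"

lemma stack_carrier [simp]: "stack n s q g \<in> carrier_mat (n * s) q"
  by (simp add: stack_def)

lemma dim_col_stack [simp]: "dim_col (stack n s q g) = q"
  by (simp add: stack_def)

lemma stack_block_stack:
  assumes "i < n"
  shows "stack_block s i (stack n s q g) = mat s q (\<lambda>(k, l). g i k l)"
proof (rule eq_matI)
  fix k l assume "k < dim_row (mat s q (\<lambda>(k, l). g i k l))" "l < dim_col (mat s q (\<lambda>(k, l). g i k l))"
  moreover from this have "i * s + k < n * s"
    using offset_block_le[OF assms, of "\<lambda>_. s"] by (simp add: offset_const)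
  ultimately show "stack_block s i (stack n s q g) $$ (k, l) = mat s q (\<lambda>(k, l). g i k l) $$ (k, l)"
    by (simp add: row_block_def stack_def offset_const)
qed (simp_all add: stack_def)

lemma index_coupling:
  assumes "dim_col V = q" "k < s" "l < q"
  shows "coupling n a s q V i $$ (k, l)
    = (\<Sum>j<n. a $$ (i, j) * (stack_block s i V $$ (k, l) - stack_block s j V $$ (k, l)))"
  using assms by (simp add: coupling_def mat_sum_def)

lemma dim_coupling [simp]:
  "dim_row (coupling n a s q V i) = s" "dim_col (coupling n a s q V i) = q"
  by (simp_all add: coupling_def mat_sum_def)

text \<open>At each fixed position \<open>(k, l)\<close> the coupling is the scalar graph Laplacian
  applied to the entries of the blocks at that position.\<close>

lemma sum_coupling_zero:
  assumes "weighted_adjacency n G a" "dim_col V = q" "k < s" "l < q"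
  shows "(\<Sum>i<n. coupling n a s q V i $$ (k, l)) = 0"
  using assms sum_laplacian_zero[of n "\<lambda>i j. a $$ (i, j)" "\<lambda>i. stack_block s i V $$ (k, l)"]
  by (simp add: index_coupling weighted_adjacency_def)

text \<open>The entries decouple: one scalar Laplacian system is solved for each position
  \<open>(k, l)\<close>, and the solutions are assembled into the blocks of
  \<open>V\<close>.\<close>

lemma coupling_surj_sum_zero:
  assumes nodes: "pverts G = {..<n}" and wf: "pair_graph G"
    and adj: "weighted_adjacency n G a"
    and conn: "Digraph_Component.connected (with_proj G)"
    and C: "\<And>i. i < n \<Longrightarrow> C i \<in> carrier_mat s q"
    and zero: "\<And>k l. k < s \<Longrightarrow> l < q \<Longrightarrow> (\<Sum>i<n. C i $$ (k, l)) = 0"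
  obtains V where "V \<in> carrier_mat (n * s) q" "\<And>i. i < n \<Longrightarrow> coupling n a s q V i = C i"
proof -
  have "\<exists>w. \<forall>i<n. (\<Sum>j<n. a $$ (i, j) * (w i - w j)) = C i $$ (k, l)" if "k < s" "l < q" for k l
    using laplacian_surj_sum_zero[OF nodes wf adj conn zero[OF that]] by metis
  then obtain w where w: "\<And>k l i. k < s \<Longrightarrow> l < q \<Longrightarrow> i < n \<Longrightarrow>
      (\<Sum>j<n. a $$ (i, j) * (w k l i - w k l j)) = C i $$ (k, l)"
    by metis
  define V where "V = stack n s q (\<lambda>i k l. w k l i)"
  have V: "V \<in> carrier_mat (n * s) q" by (simp add: V_def)
  have "coupling n a s q V i = C i" if i: "i < n" for i
  proof (rule eq_matI)
    fix k l assume "k < dim_row (C i)" "l < dim_col (C i)"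
    then have kl: "k < s" "l < q" using C[OF i] by auto
    then have "coupling n a s q V i $$ (k, l) = (\<Sum>j<n. a $$ (i, j) * (w k l i - w k l j))"
      using i by (simp add: index_coupling V_def stack_block_stack)
    then show "coupling n a s q V i $$ (k, l) = C i $$ (k, l)" using w kl i by simp
  qed (use C[OF i] in auto)
  with V show thesis by (rule that)
qed

section \<open>The distributed problem\<close>

text \<open>Cauchy-Schwarz against the all-ones vector of length \<open>n\<close>, applied at every
  entry and then summed.\<close>

lemma sum_frobenius_norm_sq_ge:
  fixes n :: nat
  assumes R: "\<And>i. i < n \<Longrightarrow> R i \<in> carrier_mat s t" and S: "S \<in> carrier_mat s t"
    and sum: "\<And>k l. k < s \<Longrightarrow> l < t \<Longrightarrow> (\<Sum>i<n. R i $$ (k, l)) = S $$ (k, l)"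
  shows "(frobenius_norm S)\<^sup>2 / n \<le> (\<Sum>i<n. (frobenius_norm (R i))\<^sup>2)"
proof -
  have "(frobenius_norm S)\<^sup>2 / n = (\<Sum>k<s. \<Sum>l<t. (\<Sum>i<n. R i $$ (k, l))\<^sup>2 / n)"
    using S sum by (simp add: frobenius_norm_sq sum_divide_distrib)
  also have "\<dots> \<le> (\<Sum>k<s. \<Sum>l<t. \<Sum>i<n. (R i $$ (k, l))\<^sup>2)"
  proof (intro sum_mono)
    fix k l
    have "(\<Sum>i<n. R i $$ (k, l))\<^sup>2 \<le> (\<Sum>i<n. (R i $$ (k, l))\<^sup>2) * n"
      using sum_squared_le_sum_of_squares[of "\<lambda>i. R i $$ (k, l)" "{..<n}"] by simp
    then show "(\<Sum>i<n. R i $$ (k, l))\<^sup>2 / n \<le> (\<Sum>i<n. (R i $$ (k, l))\<^sup>2)"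
      \<comment> \<open>For \<open>n = 0\<close> both sides are 0.\<close>
      by (cases "n = 0") (auto simp: divide_simps)
  qed
  also have "\<dots> = (\<Sum>k<s. \<Sum>i<n. \<Sum>l<t. (R i $$ (k, l))\<^sup>2)"
    by (intro sum.cong sum.swap refl)
  also have "\<dots> = (\<Sum>i<n. \<Sum>k<s. \<Sum>l<t. (R i $$ (k, l))\<^sup>2)"
    by (rule sum.swap)
  also have "\<dots> = (\<Sum>i<n. (frobenius_norm (R i))\<^sup>2)"
    using R by (intro sum.cong) (auto simp: frobenius_norm_sq)
  finally show ?thesis .
qed

lemma sum_node_residuals:
  assumes "A \<in> carrier_mat m r" "Y \<in> carrier_mat r q" "F \<in> carrier_mat m q"
    and "offset rs n = r" "offset ms n = m" and "k < m" "l < q"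
  shows "(\<Sum>i<n. (col_block rs i A * row_block rs i Y - aug_rows ms n i (row_block ms i F)) $$ (k, l))
    = (A * Y - F) $$ (k, l)"
proof -
  have "(\<Sum>i<n. (col_block rs i A * row_block rs i Y - aug_rows ms n i (row_block ms i F)) $$ (k, l))
     = (\<Sum>i<n. (col_block rs i A * row_block rs i Y) $$ (k, l))
       - (\<Sum>i<n. aug_rows ms n i (row_block ms i F) $$ (k, l))"
    \<comment> \<open>Entries of products are kept whole instead of being expanded into scalar
      products, so that the block-sum lemmas match them.\<close>
    using assms by (simp add: sum_subtractf del: index_mult_mat(1))
  also have "\<dots> = (A * Y) $$ (k, l) - F $$ (k, l)"
    using assms sum_col_block_mult_row_block[of A m rs n Y q k l] sum_aug_rows[of F ms n q k l] by simp
  finally show ?thesis using assms by simp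
qed

text \<open>By consensus any node \<open>i\<close> represents the common block of \<open>XE\<close>.
  Adding the third constraint over all nodes cancels the coupling in \<open>Z\<close> and
  reassembles \<open>Y\<close> and \<open>B\<close> from their augmented blocks.\<close>

lemma feasible_imp_Y_eq:
  assumes adj: "weighted_adjacency n G a"
    and B: "B \<in> carrier_mat p q" and rs: "offset rs n = r" and qs: "offset qs n = q"
    and feas: "ccr_feasible n m p q r rs qs a B (XE, Y, U, W, Z)" and i: "i < n"
  shows "Y = stack_block r i XE * B"
proof -
  define X where "X = stack_block r i XE"
  have XE: "XE \<in> carrier_mat (n * r) p" and Y: "Y \<in> carrier_mat r q" and Z: "Z \<in> carrier_mat (n * r) q"
    and eq: "\<And>j. j < n \<Longrightarrow> stack_block r j XE = X"
    and con: "\<And>j. j < n \<Longrightarrow> aug_rows rs n j (row_block rs j Y)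
              - stack_block r j XE * aug_cols qs n j (col_block qs j B) - coupling n a r q Z j = 0\<^sub>m r q"
    using feas i unfolding ccr_feasible_def X_def prod.case by blast+
  have X: "X \<in> carrier_mat r p" using XE by (auto simp: X_def intro!: carrier_matI)
  have "Y $$ (k, l) = (X * B) $$ (k, l)" if kl: "k < r" "l < q" for k l
  proof -
    have "aug_rows rs n j (row_block rs j Y) $$ (k, l)
        - (X * aug_cols qs n j (col_block qs j B)) $$ (k, l) - coupling n a r q Z j $$ (k, l) = 0"
      if j: "j < n" for j
      using arg_cong[OF con[OF j], of "\<lambda>M. M $$ (k, l)"] kl X B Y rs qs eq[OF j]
      by (simp del: index_mult_mat(1))
    then have "(\<Sum>j<n. aug_rows rs n j (row_block rs j Y) $$ (k, l)
        - (X * aug_cols qs n j (col_block qs j B)) $$ (k, l) - coupling n a r q Z j $$ (k, l)) = 0"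
      by simp
    then show ?thesis
      using sum_aug_rows[of Y rs n q k l] sum_mult_aug_cols[of X r p B qs n k l]
        sum_coupling_zero[OF adj, of Z q k r l] X Y B Z kl rs qs
      by (simp add: sum_subtractf del: index_mult_mat(1))
  qed
  then show ?thesis using X B Y unfolding X_def[symmetric] by (intro eq_matI) auto
qed

text \<open>Subtracting the blocks of \<open>U\<close> changes the single residuals but not their
  sum, which stays \<open>A * Y - F\<close> with \<open>Y = X * B\<close>.\<close>

lemma ccr_objective_ge:
  assumes adj: "weighted_adjacency n G a"
    and A: "A \<in> carrier_mat m r" and B: "B \<in> carrier_mat p q" and F: "F \<in> carrier_mat m q"
    and rs: "offset rs n = r" and qs: "offset qs n = q" and ms: "offset ms n = m"
    and feas: "ccr_feasible n m p q r rs qs a B (XE, Y, U, W, Z)" and i: "i < n"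
  shows "(frobenius_norm (A * stack_block r i XE * B - F))\<^sup>2 / n
    \<le> ccr_objective n rs ms A F (XE, Y, U, W, Z)"
proof -
  define X where "X = stack_block r i XE"
  have XE: "XE \<in> carrier_mat (n * r) p" and Y: "Y \<in> carrier_mat r q"
    and U: "U \<in> carrier_mat (n * m) q" and W: "W \<in> carrier_mat (n * m) q"
    and Ui: "\<And>j. j < n \<Longrightarrow> stack_block m j U = coupling n a m q W j"
    using feas unfolding ccr_feasible_def prod.case by blast+
  have X: "X \<in> carrier_mat r p" using XE by (auto simp: X_def intro!: carrier_matI)
  have Y_eq: "Y = X * B" unfolding X_def by (rule feasible_imp_Y_eq[OF adj B rs qs feas i])
  define R where "R j = col_block rs j A * row_block rs j Y - aug_rows ms n j (row_block ms j F)" for j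
  have R: "R j \<in> carrier_mat m q" for j
    using A Y F ms by (auto simp: R_def intro!: carrier_matI)
  have Uc: "stack_block m j U \<in> carrier_mat m q" for j
    using U by (auto intro!: carrier_matI)
  have "(frobenius_norm (A * Y - F))\<^sup>2 / n \<le> (\<Sum>j<n. (frobenius_norm (R j - stack_block m j U))\<^sup>2)"
  proof (rule sum_frobenius_norm_sq_ge)
    show "R j - stack_block m j U \<in> carrier_mat m q" for j by (rule minus_carrier_mat[OF Uc])
    show "A * Y - F \<in> carrier_mat m q" using F by auto
    fix k l assume kl: "k < m" "l < q"
    have "(\<Sum>j<n. stack_block m j U $$ (k, l)) = 0"
      using sum_coupling_zero[OF adj, of W q k m l] Ui W kl by simp
    moreover have "(R j - stack_block m j U) $$ (k, l) = R j $$ (k, l) - stack_block m j U $$ (k, l)" for j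
      using U kl by simp
    ultimately show "(\<Sum>j<n. (R j - stack_block m j U) $$ (k, l)) = (A * Y - F) $$ (k, l)"
      using sum_node_residuals[OF A Y F rs ms kl] by (simp only: R_def sum_subtractf)
  qed
  moreover have "A * Y = A * X * B" using A X B by (simp add: Y_eq)
  ultimately show ?thesis using A by (simp add: ccr_objective_def R_def X_def)
qed

text \<open>Equality in Cauchy-Schwarz requires all node residuals to coincide. Their sum is
  prescribed, so each must be the average of the total, and this determines
  \<open>U\<close>.\<close>

lemma ccr_objective_attained:
  assumes nodes: "pverts G = {..<n}" and wf: "pair_graph G"
    and adj: "weighted_adjacency n G a"
    and conn: "Digraph_Component.connected (with_proj G)"
    and A: "A \<in> carrier_mat m r" and B: "B \<in> carrier_mat p q" and F: "F \<in> carrier_mat m q"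
    and rs: "offset rs n = r" and qs: "offset qs n = q" and ms: "offset ms n = m"
    and X: "X \<in> carrier_mat r p"
  obtains Y U W Z where "ccr_feasible n m p q r rs qs a B (kronecker (ones_col n) X, Y, U, W, Z)"
    and "ccr_objective n rs ms A F (kronecker (ones_col n) X, Y, U, W, Z)
      = (frobenius_norm (A * X * B - F))\<^sup>2 / n"
proof -
  \<comment> \<open>Connectedness includes the existence of a node.\<close>
  have "n \<noteq> 0"
    using conn nodes by (auto simp: Digraph_Component.connected_def strongly_connected_def)
  \<comment> \<open>The only possible choice, by \<open>feasible_imp_Y_eq\<close>.\<close>
  define Y where "Y = X * B"
  have Y: "Y \<in> carrier_mat r q" using X B by (simp add: Y_def)
  define S where "S = A * Y - F"
  have S: "S \<in> carrier_mat m q" using F by (auto simp: S_def)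
  define R where "R j = col_block rs j A * row_block rs j Y - aug_rows ms n j (row_block ms j F)" for j
  have R: "R j \<in> carrier_mat m q" for j
    using A Y F ms by (auto simp: R_def intro!: carrier_matI)
  have sumR: "(\<Sum>j<n. R j $$ (k, l)) = S $$ (k, l)" if "k < m" "l < q" for k l
    unfolding R_def S_def by (rule sum_node_residuals[OF A Y F rs ms that])
  \<comment> \<open>\<open>U\<close> holds the deviations of the local residuals \<open>R i\<close>
    from their average \<open>S / n\<close>. Deviations from an average sum to zero, which makes
    them values of the coupling at some \<open>W\<close>.\<close>
  define U where "U = stack n m q (\<lambda>i k l. R i $$ (k, l) - S $$ (k, l) / n)"
  have Ui: "stack_block m i U = mat m q (\<lambda>(k, l). R i $$ (k, l) - S $$ (k, l) / n)" if "i < n" for i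
    unfolding U_def by (rule stack_block_stack[OF that])
  have "(\<Sum>i<n. stack_block m i U $$ (k, l)) = 0" if "k < m" "l < q" for k l
    using sumR[OF that] that \<open>n \<noteq> 0\<close> by (simp add: Ui sum_subtractf)
  then obtain W where W: "W \<in> carrier_mat (n * m) q"
    and UW: "\<And>i. i < n \<Longrightarrow> coupling n a m q W i = stack_block m i U"
    using coupling_surj_sum_zero[OF nodes wf adj conn, of "\<lambda>i. stack_block m i U" m q] Ui
    by (metis (no_types, lifting) mat_carrier)
  \<comment> \<open>The value that the third constraint prescribes for the coupling in
    \<open>Z\<close>. These matrices add up to \<open>Y - X * B\<close>, which is zero.\<close>
  define C where "C i = aug_rows rs n i (row_block rs i Y) - X * aug_cols qs n i (col_block qs i B)" for i
  have C: "C i \<in> carrier_mat r q" for i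
    using X B qs by (auto simp: C_def intro!: carrier_matI)
  have "(\<Sum>i<n. C i $$ (k, l)) = 0" if kl: "k < r" "l < q" for k l
  proof -
    have "C i $$ (k, l) = aug_rows rs n i (row_block rs i Y) $$ (k, l)
        - (X * aug_cols qs n i (col_block qs i B)) $$ (k, l)" for i
      using kl X B qs by (simp add: C_def del: index_mult_mat(1))
    then show ?thesis
      using sum_aug_rows[of Y rs n q k l] sum_mult_aug_cols[of X r p B qs n k l] X Y B kl rs qs
      by (simp add: sum_subtractf Y_def del: index_mult_mat(1))
  qed
  then obtain Z where Z: "Z \<in> carrier_mat (n * r) q"
    and CZ: "\<And>i. i < n \<Longrightarrow> coupling n a r q Z i = C i"
    using coupling_surj_sum_zero[OF nodes wf adj conn, of C r q] C by blast
  have XE: "kronecker (ones_col n) X \<in> carrier_mat (n * r) p"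
    using X by (simp add: kronecker_def ones_col_def)
  have "ccr_feasible n m p q r rs qs a B (kronecker (ones_col n) X, Y, U, W, Z)"
    using XE Y W Z UW CZ minus_r_inv_mat[OF C] stack_block_kronecker_ones[OF X]
    unfolding ccr_feasible_def prod.case by (simp add: U_def C_def[symmetric])
  moreover have "ccr_objective n rs ms A F (kronecker (ones_col n) X, Y, U, W, Z)
      = (frobenius_norm (A * X * B - F))\<^sup>2 / n"
  proof -
    \<comment> \<open>What remains at each node is exactly \<open>S / n\<close>; the
      \<open>n\<close> equal contributions then add up to the bound.\<close>
    have "(frobenius_norm (R i - stack_block m i U))\<^sup>2 = (frobenius_norm S)\<^sup>2 / n\<^sup>2" if "i < n" for i
      using S R[of i] by (simp add: frobenius_norm_sq Ui[OF that] sum_divide_distrib power_divide)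
    then have "(\<Sum>i<n. (frobenius_norm (R i - stack_block m i U))\<^sup>2) = (frobenius_norm S)\<^sup>2 / n"
      using \<open>n \<noteq> 0\<close> by (simp add: power2_eq_square)
    moreover have "A * Y = A * X * B" using A X B by (simp add: Y_def)
    ultimately show ?thesis using A by (simp add: ccr_objective_def R_def S_def)
  qed
  ultimately show thesis by (rule that)
qed

theorem mainTheorem6:
  fixes n m p q r :: nat
    and rs qs ms :: "nat \<Rightarrow> nat"
    and A B F a Xs :: "real mat"
    and G :: "nat pair_pre_digraph"
  assumes A: "A \<in> carrier_mat m r" and B: "B \<in> carrier_mat p q" and F: "F \<in> carrier_mat m q"
    and rs: "(\<Sum>i<n. rs i) = r" and qs: "(\<Sum>i<n. qs i) = q" and ms: "(\<Sum>i<n. ms i) = m"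
    and graph: "pair_graph G" and nodes: "pverts G = {..<n}"
    and adj: "weighted_adjacency n G a"
    and conn: "Digraph_Component.connected (with_proj G)"
    and Xs: "Xs \<in> carrier_mat r p"
  shows "least_squares_solution r p A B F Xs \<longleftrightarrow>
    (\<exists>XE Y Z U W. XE = kronecker (ones_col n) Xs \<and>
       Y \<in> carrier_mat r q \<and> Z \<in> carrier_mat (n * r) q \<and>
       U \<in> carrier_mat (n * m) q \<and> W \<in> carrier_mat (n * m) q \<and>
       is_arg_min (ccr_objective n rs ms A F) (ccr_feasible n m p q r rs qs a B) (XE, Y, U, W, Z))"
proof -
  have offs: "offset rs n = r" "offset qs n = q" "offset ms n = m"
    using rs qs ms by (simp_all add: offset_def)
  let ?f = "\<lambda>X. (frobenius_norm (A * X * B - F))\<^sup>2"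
  let ?obj = "ccr_objective n rs ms A F" and ?feas = "ccr_feasible n m p q r rs qs a B"
  have "0 < n"
    using conn nodes by (auto simp: Digraph_Component.connected_def strongly_connected_def)
  \<comment> \<open>Node 0 is taken as the representative. Together the two facts say that
    minimizing over all variables with the common block \<open>X\<close> held fixed leaves
    \<open>?f X / n\<close>.\<close>
  note lower = ccr_objective_ge[OF adj A B F offs _ \<open>0 < n\<close>]
  note attained = ccr_objective_attained[OF nodes graph adj conn A B F offs]
  show ?thesis
  proof
    assume ls: "least_squares_solution r p A B F Xs"
    obtain Y U W Z where feas: "?feas (kronecker (ones_col n) Xs, Y, U, W, Z)"
      and obj: "?obj (kronecker (ones_col n) Xs, Y, U, W, Z) = ?f Xs / n"
      using attained[OF Xs] .
    \<comment> \<open>A competitor \<open>v\<close> is compared through its own common block, read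
      off at node 0: that block is a candidate for the least squares problem.\<close>
    have "\<not> ?obj v < ?f Xs / n" if "?feas v" for v
    proof -
      obtain XE' Y' U' W' Z' where v: "v = (XE', Y', U', W', Z')" by (cases v) auto
      have "XE' \<in> carrier_mat (n * r) p"
        using that unfolding v ccr_feasible_def prod.case by blast
      then have "stack_block r 0 XE' \<in> carrier_mat r p" by (intro carrier_matI) simp_all
      then have "?f Xs \<le> ?f (stack_block r 0 XE')"
        using ls by (auto simp: least_squares_solution_def is_arg_min_def not_less)
      then have "?f Xs / n \<le> ?f (stack_block r 0 XE') / n" by (simp add: divide_right_mono)
      also have "\<dots> \<le> ?obj v" using lower that by (simp add: v)
      finally show ?thesis by simp
    qed
    then have "is_arg_min ?obj ?feas (kronecker (ones_col n) Xs, Y, U, W, Z)"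
      using feas obj by (auto simp: is_arg_min_def)
    moreover have "Y \<in> carrier_mat r q" "Z \<in> carrier_mat (n * r) q"
      "U \<in> carrier_mat (n * m) q" "W \<in> carrier_mat (n * m) q"
      using feas unfolding ccr_feasible_def prod.case by blast+
    ultimately show "\<exists>XE Y Z U W. XE = kronecker (ones_col n) Xs \<and>
       Y \<in> carrier_mat r q \<and> Z \<in> carrier_mat (n * r) q \<and>
       U \<in> carrier_mat (n * m) q \<and> W \<in> carrier_mat (n * m) q \<and>
       is_arg_min ?obj ?feas (XE, Y, U, W, Z)"
      by blast
  next
    assume "\<exists>XE Y Z U W. XE = kronecker (ones_col n) Xs \<and>
       Y \<in> carrier_mat r q \<and> Z \<in> carrier_mat (n * r) q \<and>
       U \<in> carrier_mat (n * m) q \<and> W \<in> carrier_mat (n * m) q \<and>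
       is_arg_min ?obj ?feas (XE, Y, U, W, Z)"
    then obtain Y Z U W where opt: "is_arg_min ?obj ?feas (kronecker (ones_col n) Xs, Y, U, W, Z)"
      by blast
    \<comment> \<open>Every \<open>X\<close> lifts to a feasible point of value exactly
      \<open>?f X / n\<close>, while the optimal point lying over \<open>Xs\<close> has value at
      least \<open>?f Xs / n\<close>.\<close>
    have "?f Xs \<le> ?f X" if X: "X \<in> carrier_mat r p" for X
    proof -
      obtain Y' U' W' Z' where feas: "?feas (kronecker (ones_col n) X, Y', U', W', Z')"
        and obj: "?obj (kronecker (ones_col n) X, Y', U', W', Z') = ?f X / n"
        using attained[OF X] .
      have "?f Xs / n \<le> ?obj (kronecker (ones_col n) Xs, Y, U, W, Z)"
        using lower[of "kronecker (ones_col n) Xs" Y U W Z] opt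
          stack_block_kronecker_ones[OF Xs \<open>0 < n\<close>] by (simp add: is_arg_min_def)
      also have "\<dots> \<le> ?f X / n"
        using opt feas obj by (force simp: is_arg_min_def not_less)
      finally show ?thesis using \<open>0 < n\<close> by (simp add: divide_le_cancel)
    qed
    then show "least_squares_solution r p A B F Xs"
      using Xs by (auto simp: least_squares_solution_def is_arg_min_def not_less)
  qed
qed

end
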